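(* Fix $\delta\in[0,1)$ and let $c=-\frac{1+2W_{-1}\left(-\frac{1}{2\sqrt{e}}\right)}{2}\approx 1.25643$, where $W_{-1}$ is the $-1$ branch of the Lambert $W$ function. Define the probability density on $[0,1]$ $$p_\delta(x)=\frac{(1-\delta)\left(1-e^{\frac{c}{1-\delta}}\right)}{c\left(e^{\frac{c}{1-\delta}}(x-1)-x\right)},\qquad x\in[0,1].$$ Then the continuous-time ski rental strategy that buys at time $X\sim p_\delta$ has $\mathrm{CVaR}_\delta$-competitive ratio $$\alpha_\delta^{p_\delta}=2-\frac{1}{e^{\frac{c}{1-\delta}}-1}.$$ In particular, $\alpha_\delta^{p_\delta}<2$ for all $\delta\in[0,1)$.
   Context: Conditional value-at-risk (loss convention): for a real random variable $Y$ and $\delta\in[0,1)$, $\mathrm{CVaR}_\delta[Y]=\inf_{t\in\mathbb{R}}\{t+\frac{1}{1-\delta}\mathbb{E}[(Y-t)^+]\}=\frac{1}{1-\delta}\int_\delta^1F_Y^{-1}(p)\,dp$, and $\mathrm{CVaR}_1[Y]=\operatorname{ess\,sup}Y$. For a random variable with support in a bounded interval $[a,b]$, $F^{-1}(p)=\inf\{x\in[a,b]:F(x)\ge p\}$ for $p\in[0,1]$. Continuous-time ski rental (buying cost normalized to $1$): a strategy is a probability distribution $\mu$ on $\mathbb{R}_+$ of the purchase time $X$; if the adversary chooses season length $s>0$, the cost is $C(X,s)=s\cdot\mathbb{1}_{X>s}+(X+1)\cdot\mathbb{1}_{X\le s}$. Define $\alpha_\delta^{\mu}(s)=\mathrm{CVaR}_\delta[C(X,s)]/\min\{s,1\}$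 and the $\mathrm{CVaR}_\delta$-competitive ratio $\alpha_\delta^\mu=\sup_{s>0}\alpha_\delta^\mu(s)$. *)

theory Defs
  imports "HOL-Probability.Probability"
begin

text \<open>
  The lower real branch of the Lambert function; the defining condition determines
  a unique value exactly for \<open>-1/e \<le> x < 0\<close>.
\<close>

definition lambert_Wm1 :: "real \<Rightarrow> real" where
  "lambert_Wm1 x = (THE w. w \<le> -1 \<and> w * exp w = x)"

text \<open>
  Loss-convention conditional value-at-risk.  Extended real values are used so that a loss
  of infinite expectation gets the value \<open>\<infinity>\<close>, whereas the Bochner integral would
  silently return 0.
\<close>

definition CVaR :: "'a measure \<Rightarrow> real \<Rightarrow> ('a \<Rightarrow> real) \<Rightarrow> ereal" where
  "CVaR M \<delta> Y =
     (if \<delta> = 1 then esssup M (\<lambda>\<omega>. ereal (Y \<omega>))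
      else (INF t::real. ereal t +
              ereal (1 / (1 - \<delta>)) * enn2ereal (\<integral>\<^sup>+ \<omega>. ennreal (max 0 (Y \<omega> - t)) \<partial>M)))"

text \<open>A strategy is identified with the law of its purchase time.\<close>

definition ski_strategy :: "real measure \<Rightarrow> bool" where
  "ski_strategy \<mu> \<longleftrightarrow> prob_space \<mu> \<and> sets \<mu> = sets borel \<and> (AE x in \<mu>. 0 \<le> x)"

definition ski_cost :: "real \<Rightarrow> real \<Rightarrow> real" where
  "ski_cost x s = (if x > s then s else x + 1)"

definition CVaR_ratio_at :: "real \<Rightarrow> real measure \<Rightarrow> real \<Rightarrow> ereal" where
  "CVaR_ratio_at \<delta> \<mu> s = CVaR \<mu> \<delta> (\<lambda>x. ski_cost x s) / ereal (min s 1)"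

definition CVaR_competitive_ratio :: "real \<Rightarrow> real measure \<Rightarrow> ereal" where
  "CVaR_competitive_ratio \<delta> \<mu> = (SUP s\<in>{0<..}. CVaR_ratio_at \<delta> \<mu> s)"

definition ski_c :: real where
  "ski_c = - (1 + 2 * lambert_Wm1 (- 1 / (2 * sqrt (exp 1)))) / 2"

definition ski_density :: "real \<Rightarrow> real \<Rightarrow> real" where
  "ski_density \<delta> x =
     (1 - \<delta>) * (1 - exp (ski_c / (1 - \<delta>))) /
     (ski_c * (exp (ski_c / (1 - \<delta>)) * (x - 1) - x))"

definition ski_law :: "real \<Rightarrow> real measure" where
  "ski_law \<delta> = density lborel (\<lambda>x. ennreal (ski_density \<delta> x) * indicator {0..1} x)"

end

theory Submission
  imports Defs
begin

text \<open>
  The equation defining \<open>c\<close> amounts to \<open>exp c = 2c + 1\<close>.  With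
  \<open>E = exp (c / (1 - \<delta>))\<close> and \<open>u x = E - (E - 1) x\<close>, the distribution function of the purchase time
  is \<open>1 - (1 - \<delta>) ln (u x) / c\<close>, so every expectation needed has a closed form in \<open>u\<close>.

  Upper bound: in the infimum defining CVaR take the threshold \<open>t = s\<close> if the purchase happens by time \<open>s\<close>
  with probability less than \<open>1 - \<delta>\<close>, and otherwise \<open>t = 1 + a\<close>, where \<open>X\<close> falls into \<open>[a, s]\<close> with
  probability exactly \<open>1 - \<delta>\<close>.  In the second case the ratio is explicit; in the first one the
  defect, as a function of \<open>u s\<close>, is first convex and then concave and increasing, hence nonpositive
  because it is so at both ends.

  Lower bound: for \<open>s = 1\<close> no threshold gives less than \<open>2 - 1 / (E - 1)\<close>.
\<close>

section \<open>The Lambert branch and the constant \<open>ski_c\<close>\<close>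

text \<open>The map \<open>y * exp y\<close> is strictly decreasing up to -1, so the definite
  description has at most one candidate.\<close>

lemma lambert_Wm1_eqI:
  assumes "w \<le> -1" and "w * exp w = x"
  shows "lambert_Wm1 x = w"
proof -
  have *: "b * exp b < a * exp a" if "a < b" "b \<le> -1" for a b :: real
    using \<open>a < b\<close>
  proof (rule DERIV_neg_imp_decreasing_open)
    fix y assume "a < y" "y < b"
    have "((\<lambda>y. y * exp y) has_real_derivative (1 + y) * exp y) (at y)"
      by (auto intro!: derivative_eq_intros simp: algebra_simps)
    moreover have "(1 + y) * exp y < 0"
      using \<open>y < b\<close> \<open>b \<le> -1\<close> by (simp add: mult_neg_pos)
    ultimately show "\<exists>d. ((\<lambda>y. y * exp y) has_real_derivative d) (at y) \<and> d < 0"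
      by blast
  qed (intro continuous_intros)
  show ?thesis
    unfolding lambert_Wm1_def
  proof (rule the_equality)
    fix v :: real assume v: "v \<le> -1 \<and> v * exp v = x"
    then show "v = w"
      using assms *[of v w] *[of w v] by (cases v w rule: linorder_cases) auto
  qed (use assms in simp)
qed

lemma ski_c: "exp ski_c = 2 * ski_c + 1" "61 / 50 \<le> ski_c"
proof -
  \<comment> \<open>\<open>c \<approx> 1.25643\<close>; the lower bound 61/50 is what makes
    \<open>1 \<le> (c - 1) * E * (E - 2)\<close> true for all \<open>E \<ge> 2c + 1\<close>.\<close>
  have "(1 - 61 / 3200) ^ 64 \<le> exp (- (61 / 3200) :: real) ^ 64"
    using exp_ge_add_one_self[of "- (61 / 3200)"] by (intro power_mono) auto
  also have "\<dots> = exp (- (61 / 50))"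
    by (simp flip: exp_of_nat_mult)
  finally have "(3139 / 3200) ^ 64 \<le> exp (- (61 / 50::real))"
    by simp
  \<comment> \<open>Cutting 61/50 into 64 equal parts makes \<open>1 + y \<le> exp y\<close> sharp
    enough; what remains is rational arithmetic.\<close>
  moreover have "1 / (2 * (61 / 50) + 1) \<le> (3139 / 3200 :: real) ^ 64"
    by (simp add: field_simps)
  ultimately have "1 / (2 * (61 / 50) + 1) \<le> exp (- (61 / 50::real))"
    by linarith
  then have lo: "exp (61 / 50) - 2 * (61 / 50) - 1 \<le> (0::real)"
    by (simp add: exp_minus field_simps)
  have hi: "0 \<le> exp 2 - 2 * 2 - (1::real)"
    using exp_lower_Taylor_quadratic[of "2::real"] by simp
  \<comment> \<open>Starting at 61/50 avoids the other root 0 of \<open>exp c = 2 * c + 1\<close>,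
    which belongs to the principal branch.\<close>
  obtain c :: real where c: "61 / 50 \<le> c" "exp c - 2 * c - 1 = 0"
    using IVT'[of "\<lambda>c::real. exp c - 2 * c - 1" "61 / 50" 0 2] lo hi
    by (force intro!: continuous_intros)
  \<comment> \<open>The candidate \<open>- c - 1 / 2\<close> is the definition of
    \<open>ski_c\<close> solved for the Lambert value.\<close>
  have "(- c - 1 / 2) * exp (- c - 1 / 2) = - 1 / (2 * sqrt (exp 1))"
  proof -
    have s: "sqrt (exp 1) = exp (1 / 2)"
      by (rule real_sqrt_unique) (auto simp: power2_eq_square simp flip: exp_add)
    have "exp (- c - 1 / 2) = exp (- (c + 1 / 2))"
      by simp
    also have "\<dots> = 1 / (exp c * exp (1 / 2))"
      by (simp only: exp_minus exp_add inverse_eq_divide)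
    also have "\<dots> = 1 / ((2 * c + 1) * exp (1 / 2))"
      using c by simp
    finally have e: "exp (- c - 1 / 2) = 1 / ((2 * c + 1) * exp (1 / 2))" .
    have "2 * c + 1 \<noteq> 0"
      using c(1) by linarith
    then show ?thesis
      unfolding s e by (simp add: divide_simps)
  qed
  then have "lambert_Wm1 (- 1 / (2 * sqrt (exp 1))) = - c - 1 / 2"
    using c by (intro lambert_Wm1_eqI) auto
  then have "ski_c = c"
    by (simp add: ski_c_def)
  then show "exp ski_c = 2 * ski_c + 1" "61 / 50 \<le> ski_c"
    using c by auto
qed

section \<open>A sign criterion for convex-then-concave functions\<close>

text \<open>Right of \<open>m\<close>, concavity keeps \<open>f'\<close> above \<open>f' b\<close>,
  so \<open>f\<close> rises to \<open>f b\<close>; left of \<open>m\<close>, convexity bounds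
  \<open>f\<close> by its values at the ends of that stretch. The point \<open>m\<close> may lie
  outside the interval.\<close>

lemma convex_then_concave_bound:
  fixes f f' f'' :: "real \<Rightarrow> real"
  assumes "a \<le> b"
    and "\<And>x. a \<le> x \<Longrightarrow> x \<le> b \<Longrightarrow> (f has_real_derivative f' x) (at x)"
    and "\<And>x. a \<le> x \<Longrightarrow> x \<le> b \<Longrightarrow> (f' has_real_derivative f'' x) (at x)"
    and "\<And>x. a \<le> x \<Longrightarrow> x \<le> b \<Longrightarrow> x \<le> m \<Longrightarrow> 0 \<le> f'' x"
    and "\<And>x. a \<le> x \<Longrightarrow> x \<le> b \<Longrightarrow> m \<le> x \<Longrightarrow> f'' x \<le> 0"
    and "f a \<le> 0" and "f b \<le> 0" and "0 \<le> f' b"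
    and "x \<in> {a..b}"
  shows "f x \<le> 0"
proof -
  have right: "f y \<le> 0" if "y \<in> {a..b}" "m \<le> y" for y
  proof -
    have "0 \<le> f' z" if "y \<le> z" "z \<le> b" for z
    proof -
      have "f' b \<le> f' z"
        using that \<open>y \<in> {a..b}\<close> \<open>m \<le> y\<close> assms(3,5)
        by (intro DERIV_nonpos_imp_nonincreasing[of z b f']) (auto, smt (verit))
      then show ?thesis using assms(8) by simp
    qed
    then have "f y \<le> f b"
      using that assms(2) by (intro DERIV_nonneg_imp_nondecreasing[of y b f]) (auto, smt (verit))
    then show ?thesis using assms(7) by simp
  qed
  show ?thesis
  proof (cases "m \<le> x")
    case True
    then show ?thesis using right assms(9) by simp
  next
    case False
    define e where "e = min m b"
    have e: "a \<le> e" "e \<le> b" "e \<le> m" "x \<in> {a..e}" "f e \<le> 0"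
      using False assms(7,9) right[of m] by (auto simp: e_def min_def)
    have "convex_on {a..e} f"
      using e assms by (intro f''_ge0_imp_convex[of _ f f' f'']) auto
    then have "f x \<le> max (f a) (f e)"
      using convex_on_le_max[of a e f x] e(4) by auto
    then show ?thesis using assms(6) e(5) by simp
  qed
qed

section \<open>The purchase law and its truncated moments in closed form\<close>

locale ski_rental =
  fixes \<delta> :: real
  assumes delta: "0 \<le> \<delta>" "\<delta> < 1"
begin

definition E :: real where "E = exp (ski_c / (1 - \<delta>))"

text \<open>Up to sign the bracket in the denominator of \<open>ski_density\<close>; it falls from
  \<open>E\<close> at 0 to 1 at 1, hence is positive on the unit interval.\<close>

definition u :: "real \<Rightarrow> real" where "u x = E - (E - 1) * x"

lemma c_pos: "0 < ski_c"
  using ski_c(2) by simp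

lemma E_ge: "exp ski_c \<le> E"
  using delta c_pos by (simp add: E_def le_divide_eq mult_left_le)

lemma E_gt: "3 < E"
  using E_ge ski_c by simp

lemma ln_E: "ln E = ski_c / (1 - \<delta>)"
  by (simp add: E_def)

lemma u_antimono: "x \<le> y \<Longrightarrow> u y \<le> u x"
  using E_gt by (simp add: u_def mult_left_mono)

lemma u_1: "u 1 = 1"
  by (simp add: u_def)

lemma u_ge: "x \<le> 1 \<Longrightarrow> 1 \<le> u x"
  using u_antimono[of x 1] by (simp add: u_1)

lemma ski_density_eq: "ski_density \<delta> x = (1 - \<delta>) * (E - 1) / (ski_c * u x)"
proof -
  have "(1 - \<delta>) * (1 - E) / (ski_c * (E * (x - 1) - x)) =
      (- ((1 - \<delta>) * (E - 1))) / (- (ski_c * u x))"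
    by (simp add: u_def algebra_simps)
  then show ?thesis
    unfolding ski_density_def E_def[symmetric] by (simp only: minus_divide_divide)
qed

lemma ski_density_nonneg: "x \<le> 1 \<Longrightarrow> 0 \<le> ski_density \<delta> x"
  unfolding ski_density_eq using u_ge[of x] delta c_pos E_gt by (intro divide_nonneg_nonneg) auto

lemma borel_measurable_ski_density [measurable]: "ski_density \<delta> \<in> borel_measurable borel"
  unfolding ski_density_def[abs_def] by measurable

lemma borel_measurable_ski_cost [measurable]: "(\<lambda>x. ski_cost x s) \<in> borel_measurable borel"
  unfolding ski_cost_def by measurable

lemma sets_ski_law [measurable_cong]: "sets (ski_law \<delta>) = sets borel"
  by (simp add: ski_law_def)

lemma u_deriv: "(u has_real_derivative - (E - 1)) (at x)"
  unfolding u_def[abs_def] by (auto intro!: derivative_eq_intros)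

text \<open>An antiderivative of \<open>(x - a) * ski_density \<delta> x\<close>.\<close>
definition H :: "real \<Rightarrow> real \<Rightarrow> real" where
  "H a x = (1 - \<delta>) * (u x - u a * ln (u x)) / (ski_c * (E - 1))"

lemma H_deriv:
  assumes "x \<le> 1"
  shows "(H a has_real_derivative (x - a) * ski_density \<delta> x) (at x)"
proof -
  have "0 < u x" using u_ge[OF assms] by simp
  then have "(H a has_real_derivative
      (1 - \<delta>) * (- (E - 1) - u a * (1 / u x * - (E - 1))) / (ski_c * (E - 1))) (at x)"
    unfolding H_def[abs_def]
    by (intro DERIV_cdivide DERIV_cmult DERIV_diff u_deriv DERIV_chain2[OF DERIV_ln_divide])
  also have "(1 - \<delta>) * (- (E - 1) - u a * (1 / u x * - (E - 1))) / (ski_c * (E - 1))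
      = (1 - \<delta>) * (u a - u x) / (ski_c * u x)"
    using \<open>0 < u x\<close> E_gt c_pos by (simp add: divide_simps) (simp add: algebra_simps)
  also have "u a - u x = (E - 1) * (x - a)"
    by (simp add: u_def algebra_simps)
  finally show ?thesis
    by (simp add: ski_density_eq mult_ac)
qed

text \<open>Monotonicity comes along because \<open>ennreal\<close> truncates negative differences
  to 0; \<open>V_eq\<close> needs it to return to the reals.\<close>

lemma nn_integral_H:
  assumes "a \<le> l" "l \<le> r" "r \<le> 1"
  shows "(\<integral>\<^sup>+x. ennreal ((x - a) * ski_density \<delta> x) * indicator {l..r} x \<partial>lborel)
    = ennreal (H a r - H a l)" and "H a l \<le> H a r"
proof -
  have nn: "0 \<le> (x - a) * ski_density \<delta> x" if "l \<le> x" "x \<le> r" for x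
    using that assms ski_density_nonneg[of x] by simp
  show "(\<integral>\<^sup>+x. ennreal ((x - a) * ski_density \<delta> x) * indicator {l..r} x \<partial>lborel)
    = ennreal (H a r - H a l)"
    using assms nn by (intro nn_integral_FTC_Icc H_deriv) auto
  show "H a l \<le> H a r"
    using assms(2)
  proof (rule DERIV_nonneg_imp_nondecreasing)
    fix x assume "l \<le> x" "x \<le> r"
    then show "\<exists>y. (H a has_real_derivative y) (at x) \<and> 0 \<le> y"
      using H_deriv[of x a] nn[of x] assms(3) by auto
  qed
qed

lemma nn_integral_ski_law:
  assumes [measurable]: "f \<in> borel_measurable borel"
  shows "(\<integral>\<^sup>+x. f x \<partial>ski_law \<delta>) =
    (\<integral>\<^sup>+x. ennreal (ski_density \<delta> x) * indicator {0..1} x * f x \<partial>lborel)"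
  unfolding ski_law_def by (intro nn_integral_density) auto

lemma ski_strategy_ski_law: "ski_strategy (ski_law \<delta>)"
proof -
  let ?F = "\<lambda>x. - (1 - \<delta>) * ln (u x) / ski_c"
  have "(?F has_real_derivative ski_density \<delta> x) (at x)" if "x \<le> 1" for x
  proof -
    have "(?F has_real_derivative - (1 - \<delta>) * (1 / u x * - (E - 1)) / ski_c) (at x)"
      using u_ge[OF that]
      by (intro DERIV_cdivide DERIV_cmult u_deriv DERIV_chain2[OF DERIV_ln_divide]) auto
    moreover have "- (1 - \<delta>) * (1 / u x * - (E - 1)) / ski_c = ski_density \<delta> x"
      by (simp add: ski_density_eq algebra_simps)
    ultimately show ?thesis
      by (simp only:)
  qed
  then have "(\<integral>\<^sup>+x. ennreal (ski_density \<delta> x) * indicator {0..1} x \<partial>lborel) = ennreal (?F 1 - ?F 0)"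
    by (intro nn_integral_FTC_Icc) (auto simp: ski_density_nonneg)
  \<comment> \<open>The difference is \<open>(1 - \<delta>) * ln E / ski_c\<close>, and
    \<open>E\<close> is chosen to make this 1.\<close>
  also have "?F 1 - ?F 0 = 1"
    using delta c_pos by (simp add: u_def ln_E field_simps)
  finally have "emeasure (ski_law \<delta>) (space (ski_law \<delta>)) = 1"
    unfolding ski_law_def by (subst emeasure_density) auto
  then have "prob_space (ski_law \<delta>)"
    by (rule prob_spaceI)
  moreover have "AE x in ski_law \<delta>. 0 \<le> x"
    unfolding ski_law_def by (subst AE_density) (auto split: split_indicator)
  ultimately show ?thesis
    by (simp add: ski_strategy_def sets_ski_law)
qed

text \<open>The objective of the CVaR infimum at \<open>t = 1 + a\<close>, when exactly the purchases in \<open>[l, r]\<close>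
  exceed the threshold.\<close>
definition V :: "real \<Rightarrow> real \<Rightarrow> real \<Rightarrow> real" where
  "V a l r = 1 + a + (u r - u l + u a * (ln (u l) - ln (u r))) / (ski_c * (E - 1))"

text \<open>The CVaR factor cancels the \<open>1 - \<delta>\<close> of the density, so
  \<open>\<delta>\<close> enters \<open>V\<close> only through \<open>E\<close>.\<close>

lemma V_eq: "ereal (1 + a) + ereal (1 / (1 - \<delta>)) * enn2ereal (ennreal (H a r - H a l)) = ereal (V a l r)"
  if "H a l \<le> H a r"
proof -
  have "H a r - H a l =
      (1 - \<delta>) * ((u r - u l + u a * (ln (u l) - ln (u r))) / (ski_c * (E - 1)))"
    unfolding H_def times_divide_eq_right diff_divide_distrib[symmetric] by (simp add: algebra_simps)
  then have "1 / (1 - \<delta>) * (H a r - H a l) = (u r - u l + u a * (ln (u l) - ln (u r))) / (ski_c * (E - 1))"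
    using delta by simp
  then show ?thesis
    using that by (simp add: V_def)
qed

section \<open>Comparing the CVaR objective with \<open>V\<close>\<close>

text \<open>A threshold \<open>1 + a\<close> of at least \<open>min s 1\<close> is not exceeded when
  no purchase happens in time; a purchase at \<open>x\<close> exceeds it by \<open>x - a\<close>.
  The law lives on the unit interval, which explains the cut at 1.\<close>

lemma CVaR_le_V:
  assumes "0 < s" "min s 1 \<le> 1 + a" "a \<le> min s 1"
  shows "CVaR (ski_law \<delta>) \<delta> (\<lambda>x. ski_cost x s) \<le> ereal (V a (max a 0) (min s 1))"
proof -
  let ?l = "max a 0" and ?r = "min s 1"
  have lr: "a \<le> ?l" "?l \<le> ?r" "?r \<le> 1"
    using assms by auto
  have "(\<integral>\<^sup>+x. ennreal (max 0 (ski_cost x s - (1 + a))) \<partial>ski_law \<delta>) =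
    (\<integral>\<^sup>+x. ennreal (ski_density \<delta> x) * indicator {0..1} x
      * ennreal (max 0 (ski_cost x s - (1 + a))) \<partial>lborel)"
    by (rule nn_integral_ski_law) measurable
  also have "\<dots> \<le> (\<integral>\<^sup>+x. ennreal ((x - a) * ski_density \<delta> x) * indicator {?l..?r} x \<partial>lborel)"
  proof (rule nn_integral_mono)
    fix x :: real
    show "ennreal (ski_density \<delta> x) * indicator {0..1} x * ennreal (max 0 (ski_cost x s - (1 + a)))
      \<le> ennreal ((x - a) * ski_density \<delta> x) * indicator {?l..?r} x"
    proof (cases "x \<in> {?l..?r}")
      case True
      then show ?thesis
        using ski_density_nonneg[of x]
        by (auto simp: ski_cost_def ennreal_mult'' mult.commute split: split_indicator)
    next
      case False
      show ?thesis
      proof (cases "x \<in> {0..1}")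
        case True
        then have "max 0 (ski_cost x s - (1 + a)) = 0"
          using False assms by (auto simp: ski_cost_def)
        then show ?thesis
          by (simp only:) simp
      qed simp
    qed
  qed
  also have "\<dots> = ennreal (H a ?r - H a ?l)"
    by (rule nn_integral_H(1)[OF lr])
  finally have "ereal (1 + a) + ereal (1 / (1 - \<delta>)) *
      enn2ereal (\<integral>\<^sup>+x. ennreal (max 0 (ski_cost x s - (1 + a))) \<partial>ski_law \<delta>) \<le> ereal (V a ?l ?r)"
    unfolding V_eq[OF nn_integral_H(2)[OF lr], symmetric] using delta
    by (intro add_left_mono ereal_mult_left_mono) (auto simp: less_eq_ennreal.rep_eq)
  then show ?thesis
    unfolding CVaR_def using delta by (auto intro: INF_lower2)
qed

text \<open>Discarding purchases before \<open>l\<close> only lowers the integral, so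
  \<open>l\<close> can be chosen freely for each threshold.\<close>

lemma V_le_CVaR_integrand:
  assumes "a \<le> l" "0 \<le> l" "l \<le> 1"
  shows "ereal (V a l 1) \<le> ereal (1 + a) + ereal (1 / (1 - \<delta>)) *
      enn2ereal (\<integral>\<^sup>+x. ennreal (max 0 (ski_cost x 1 - (1 + a))) \<partial>ski_law \<delta>)"
proof -
  have lr: "a \<le> l" "l \<le> 1" "(1::real) \<le> 1"
    using assms by auto
  have "ennreal (H a 1 - H a l) =
      (\<integral>\<^sup>+x. ennreal ((x - a) * ski_density \<delta> x) * indicator {l..1} x \<partial>lborel)"
    by (rule nn_integral_H(1)[OF lr, symmetric])
  also have "\<dots> \<le> (\<integral>\<^sup>+x. ennreal (ski_density \<delta> x) * indicator {0..1} x
      * ennreal (max 0 (ski_cost x 1 - (1 + a))) \<partial>lborel)"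
  proof (rule nn_integral_mono)
    fix x :: real
    show "ennreal ((x - a) * ski_density \<delta> x) * indicator {l..1} x
      \<le> ennreal (ski_density \<delta> x) * indicator {0..1} x * ennreal (max 0 (ski_cost x 1 - (1 + a)))"
      using assms ski_density_nonneg[of x]
      by (auto simp: ski_cost_def ennreal_mult'' mult.commute split: split_indicator)
  qed
  also have "\<dots> = (\<integral>\<^sup>+x. ennreal (max 0 (ski_cost x 1 - (1 + a))) \<partial>ski_law \<delta>)"
    by (rule nn_integral_ski_law[symmetric]) measurable
  finally show ?thesis
    unfolding V_eq[OF nn_integral_H(2)[OF lr], symmetric] using delta
    by (intro add_left_mono ereal_mult_left_mono) (auto simp: less_eq_ennreal.rep_eq)
qed

section \<open>The upper bound for every season length\<close>

definition \<alpha> :: real where "\<alpha> = 2 - 1 / (E - 1)"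

lemma alpha_eq: "\<alpha> = 1 + (E - 2) / (E - 1)"
  using E_gt by (simp add: \<alpha>_def field_simps)

text \<open>For \<open>v = u a\<close> the first two summands are the threshold
  \<open>1 + a\<close>.\<close>

lemma alpha_split: "1 + (E - v) / (E - 1) + (v - 2) / (E - 1) = \<alpha>"
  by (simp add: alpha_eq flip: add_divide_distrib)

lemma u_inverse: "u ((E - v) / (E - 1)) = v"
  using E_gt by (simp add: u_def)

lemma late_season:
  assumes "u r \<le> E / exp ski_c" "r \<le> 1"
  obtains a where "0 \<le> a" "a \<le> r" "V a a r \<le> r * \<alpha>"
proof
  \<comment> \<open>Purchases in \<open>[a, r]\<close> have probability
    \<open>(1 - \<delta>) * (ln (u a) - ln (u r)) / ski_c\<close>; this is
    \<open>1 - \<delta>\<close> exactly if \<open>u a = ?v\<close>. The assumption on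
    \<open>u r\<close> makes this \<open>a\<close> nonnegative.\<close>
  let ?v = "u r * exp ski_c"
  let ?a = "(E - ?v) / (E - 1)"
  have ua: "u ?a = ?v" by (rule u_inverse)
  have "?v \<le> E" using assms by (simp add: field_simps)
  then show "0 \<le> ?a" using E_gt by simp
  have ur: "1 \<le> u r" using u_ge assms by simp
  have "u r \<le> ?v" using ur c_pos by simp
  then have "?a \<le> (E - u r) / (E - 1)"
    using E_gt by (intro divide_right_mono) auto
  also have "\<dots> = r" using E_gt by (simp add: u_def field_simps)
  finally show "?a \<le> r" .
  have "ln ?v = ln (u r) + ski_c"
    using ur by (simp add: ln_mult)
  then have "V ?a ?a r = 1 + ?a + (u r - ?v + ?v * ski_c) / (ski_c * (E - 1))"
    by (simp add: V_def ua)
  also have "(u r - ?v + ?v * ski_c) / (ski_c * (E - 1)) =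
      (u r * (1 - exp ski_c) / ski_c + ?v) / (E - 1)"
  proof -
    have "(u r - ?v + ?v * ski_c) / ski_c = u r * (1 - exp ski_c) / ski_c + ?v"
      using c_pos by (simp add: field_simps)
    then show ?thesis
      by (simp flip: divide_divide_eq_left)
  qed
  also have "1 + ?a + (u r * (1 - exp ski_c) / ski_c + ?v) / (E - 1) =
      1 + (E + u r * (1 - exp ski_c) / ski_c) / (E - 1)"
    by (simp flip: add_divide_distrib)
  \<comment> \<open>Here \<open>exp ski_c = 2 * ski_c + 1\<close> makes the value linear in
    \<open>r\<close>.\<close>
  also have "(u r * (1 - exp ski_c)) / ski_c = - 2 * u r"
    using ski_c c_pos by simp
  also have "1 + (E + - 2 * u r) / (E - 1) = 2 * r - 1 / (E - 1)"
    using E_gt by (simp add: u_def field_simps)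
  also have "\<dots> \<le> r * \<alpha>"
    using assms E_gt by (simp add: \<alpha>_def right_diff_distrib divide_right_mono)
  finally show "V ?a ?a r \<le> r * \<alpha>" .
qed

text \<open>With \<open>v = u s\<close> the left side is \<open>V (s - 1) 0 s - s * \<alpha>\<close>
  scaled by \<open>ski_c * (E - 1)\<close>. The end \<open>v = E\<close> is \<open>s = 0\<close>,
  where it vanishes.\<close>

lemma early_season_aux:
  assumes "E / exp ski_c \<le> v" "v \<le> E"
  shows "(v + E - 1) * (ln E - ln v) - (E - v) - ski_c * (E - v) * ((E - 2) / (E - 1)) \<le> 0"
proof -
  let ?c = "ski_c"
  define B where "B = (E - 2) / (E - 1)"
  define a where "a = E / exp ?c"
  have a1: "1 \<le> a" using E_ge by (simp add: a_def)
  have aE: "a \<le> E" using E_gt c_pos by (simp add: a_def field_simps)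
  have "0 < E" using E_gt by simp
  show ?thesis
    unfolding B_def[symmetric]
  \<comment> \<open>The second derivative is \<open>(E - 1 - x) / x\<^sup>2\<close>, hence the
    choice of \<open>m\<close>.\<close>
  proof (rule convex_then_concave_bound[where a = a and b = E and x = v and m = "E - 1"
      and f' = "\<lambda>v. ln E - ln v - (v + E - 1) / v + 1 + ?c * B"
      and f'' = "\<lambda>v. - 1 / v + (E - 1) / v\<^sup>2"])
    show "a \<le> E" by (rule aE)
    fix x assume "a \<le> x"
    then have x: "0 < x" using a1 by linarith
    show "((\<lambda>v. (v + E - 1) * (ln E - ln v) - (E - v) - ?c * (E - v) * B)
        has_real_derivative ln E - ln x - (x + E - 1) / x + 1 + ?c * B) (at x)"
      using x by (auto intro!: derivative_eq_intros simp: field_simps)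
    show "((\<lambda>v. ln E - ln v - (v + E - 1) / v + 1 + ?c * B)
        has_real_derivative - 1 / x + (E - 1) / x\<^sup>2) (at x)"
      using x by (auto intro!: derivative_eq_intros simp: field_simps power2_eq_square)
    have *: "- 1 / x + (E - 1) / x\<^sup>2 = (E - 1 - x) / x\<^sup>2"
      using x by (simp add: field_simps power2_eq_square)
    show "x \<le> E - 1 \<Longrightarrow> 0 \<le> - 1 / x + (E - 1) / x\<^sup>2"
      unfolding * by simp
    show "E - 1 \<le> x \<Longrightarrow> - 1 / x + (E - 1) / x\<^sup>2 \<le> 0"
      unfolding * by (simp add: divide_nonpos_nonneg)
  next
    \<comment> \<open>At the left end the logarithms differ by \<open>?c\<close>, and the value
      reduces to \<open>?c * ((E - a) / (E - 1) - 1)\<close>, nonpositive since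
      \<open>1 \<le> a\<close>.\<close>
    have Ea: "E = (2 * ?c + 1) * a"
      using ski_c c_pos by (simp add: a_def)
    then have Eva: "E - a = 2 * ?c * a"
      by (simp add: algebra_simps)
    have "ln E - ln a = ?c"
      using \<open>0 < E\<close> by (simp add: a_def ln_div)
    moreover have "(a + E - 1) * ?c - 2 * ?c * a - ?c * (2 * ?c * a) * B =
        ?c * (2 * ?c * a / (E - 1) - 1)"
    proof -
      have "B = 1 - 1 / (E - 1)" using E_gt by (simp add: B_def field_simps)
      then have "(a + E - 1) * ?c - 2 * ?c * a - ?c * (2 * ?c * a) * B =
        ?c * ((E - a - 2 * ?c * a) + 2 * ?c * a / (E - 1) - 1)"
        by (simp only:) (simp add: algebra_simps)
      then show ?thesis using Eva by simp
    qed
    moreover have "2 * ?c * a / (E - 1) \<le> 1"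
      unfolding Eva[symmetric] using a1 E_gt by simp
    ultimately show "(a + E - 1) * (ln E - ln a) - (E - a) - ?c * (E - a) * B \<le> 0"
      unfolding Eva using c_pos by (simp add: mult_le_0_iff)
  next
    \<comment> \<open>The slope at \<open>E\<close> is \<open>?c * B - (E - 1) / E\<close>. As
      \<open>(E - 1)\<^sup>2 = E * (E - 2) + 1\<close>, its sign reduces to
      \<open>1 \<le> (?c - 1) * (E * (E - 2))\<close>, which follows from
      \<open>2 * ?c + 1 \<le> E\<close> and the numeric bound on \<open>?c\<close>.\<close>
    have "4 * (61 / 50) ^ 2 - 1 \<le> 4 * ?c ^ 2 - 1"
      using power_mono[OF ski_c(2), of 2] by simp
    also have "\<dots> = (2 * ?c + 1) * (2 * ?c + 1 - 2)"
      by (simp add: algebra_simps power2_eq_square)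
    also have "\<dots> \<le> E * (E - 2)"
      using E_ge ski_c by (intro mult_mono) auto
    finally have "61 / 50 - 1 \<le> ?c - 1 \<and> 4 * (61 / 50) ^ 2 - 1 \<le> E * (E - 2)"
      using ski_c by simp
    then have "(61 / 50 - 1) * (4 * (61 / 50) ^ 2 - 1) \<le> (?c - 1) * (E * (E - 2))"
      by (intro mult_mono) (auto simp: power2_eq_square)
    then have "1 \<le> (?c - 1) * (E * (E - 2))"
      by (simp add: power2_eq_square)
    then have "(E - 1) * (E - 1) \<le> ?c * (E - 2) * E"
      by (simp add: algebra_simps)
    then have "(E - 1) / E \<le> ?c * B"
      using E_gt by (simp add: B_def divide_le_eq le_divide_eq)
    moreover have "(E + E - 1) / E = 1 + (E - 1) / E"
      using E_gt by (simp add: field_simps)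
    ultimately show "0 \<le> ln E - ln E - (E + E - 1) / E + 1 + ?c * B"
      by simp
  qed (use assms in \<open>auto simp: a_def\<close>)
qed

text \<open>The threshold is \<open>s\<close> itself, so \<open>a = s - 1\<close> and every purchase
  in \<open>[0, s]\<close> exceeds it.\<close>

lemma early_season:
  assumes "E / exp ski_c \<le> u s" "0 \<le> s"
  shows "V (s - 1) 0 s \<le> s * \<alpha>"
proof -
  have E: "0 < E - 1" using E_gt by simp
  have "u s \<le> E" using assms(2) E by (simp add: u_def)
  have Es: "E - u s = s * (E - 1)" by (simp add: u_def)
  have u: "u 0 = E" "u (s - 1) = u s + E - 1"
    by (simp_all add: u_def algebra_simps)
  have "u s - E + y = y - (E - u s)" for y
    by simp
  then have "V (s - 1) 0 s = s + ((u s + E - 1) * (ln E - ln (u s)) - (E - u s)) / (ski_c * (E - 1))"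
    by (simp only: V_def u)
  also have "\<dots> \<le> s + (ski_c * (E - u s) * ((E - 2) / (E - 1))) / (ski_c * (E - 1))"
    using early_season_aux[OF assms(1) \<open>u s \<le> E\<close>] c_pos E
    by (intro add_left_mono divide_right_mono) auto
  also have "\<dots> = s * \<alpha>"
    using c_pos E by (simp add: Es alpha_eq distrib_left)
  finally show ?thesis .
qed

lemma CVaR_ratio_at_le:
  assumes "0 < s"
  shows "CVaR_ratio_at \<delta> (ski_law \<delta>) s \<le> ereal \<alpha>"
proof -
  let ?r = "min s 1"
  have "CVaR (ski_law \<delta>) \<delta> (\<lambda>x. ski_cost x s) \<le> ereal (?r * \<alpha>)"
  \<comment> \<open>By the distribution function, this asks whether a purchase by time
    \<open>?r\<close> has probability at least \<open>1 - \<delta>\<close>.\<close>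
  proof (cases "u ?r \<le> E / exp ski_c")
    case True
    then obtain a where a: "0 \<le> a" "a \<le> ?r" "V a a ?r \<le> ?r * \<alpha>"
      using late_season[of ?r] by auto
    then have "CVaR (ski_law \<delta>) \<delta> (\<lambda>x. ski_cost x s) \<le> ereal (V a a ?r)"
      using CVaR_le_V[of s a] assms by (auto simp: max_def)
    also have "\<dots> \<le> ereal (?r * \<alpha>)" using a by simp
    finally show ?thesis .
  next
    case False
    then have F: "V (?r - 1) 0 ?r \<le> ?r * \<alpha>"
      using early_season[of ?r] assms by auto
    have "max (?r - 1) 0 = 0" by simp
    moreover have "CVaR (ski_law \<delta>) \<delta> (\<lambda>x. ski_cost x s) \<le> ereal (V (?r - 1) (max (?r - 1) 0) ?r)"
      using assms by (intro CVaR_le_V) linarith+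
    ultimately have "CVaR (ski_law \<delta>) \<delta> (\<lambda>x. ski_cost x s) \<le> ereal (V (?r - 1) 0 ?r)"
      by (simp only:)
    also have "\<dots> \<le> ereal (?r * \<alpha>)" using F by simp
    finally show ?thesis .
  qed
  then have "CVaR_ratio_at \<delta> (ski_law \<delta>) s \<le> ereal (?r * \<alpha>) / ereal ?r"
    unfolding CVaR_ratio_at_def using assms by (intro ereal_divide_right_mono) auto
  also have "\<dots> = ereal \<alpha>"
    using assms by (auto simp: min_def)
  finally show ?thesis .
qed

section \<open>The lower bound at season length 1 and the exact ratio\<close>

lemma alpha_le_CVaR: "ereal \<alpha> \<le> CVaR (ski_law \<delta>) \<delta> (\<lambda>x. ski_cost x 1)"
proof -
  let ?c = "ski_c" 
  \<comment> \<open>The point \<open>q\<close> is the \<open>\<delta>\<close>-quantile: purchases in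
    \<open>[q, 1]\<close> have probability \<open>1 - \<delta>\<close>.\<close>
  define q where "q = (E - exp ?c) / (E - 1)"
  have uq: "u q = exp ?c" unfolding q_def by (rule u_inverse)
  have q: "0 \<le> q" "q \<le> 1"
    using E_ge E_gt c_pos by (auto simp: q_def)
  have a_eq: "a = (E - u a) / (E - 1)" for a
    using E_gt by (simp add: u_def)
  have "ereal \<alpha> \<le> ereal (1 + a) + ereal (1 / (1 - \<delta>)) *
      enn2ereal (\<integral>\<^sup>+x. ennreal (max 0 (ski_cost x 1 - (1 + a))) \<partial>ski_law \<delta>)" for a
  proof -
    consider "a \<le> q" | "q \<le> a" "a \<le> 1" | "1 \<le> a" by linarith
    then show ?thesis
    proof cases
      case 1
      \<comment> \<open>Cutting at \<open>q\<close> makes the objective independent of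
        \<open>a\<close>: raising the threshold is offset exactly by the smaller excess.\<close>
      have "V a q 1 = 1 + a + (1 - exp ?c + u a * ?c) / (?c * (E - 1))"
        by (simp add: V_def uq u_1)
      also have "\<dots> = 1 + a + ?c * (u a - 2) / (?c * (E - 1))"
        using ski_c by (simp add: algebra_simps)
      also have "\<dots> = 1 + (E - u a) / (E - 1) + (u a - 2) / (E - 1)"
        using c_pos a_eq[of a] by simp
      also have "\<dots> = \<alpha>"
        by (rule alpha_split)
      finally show ?thesis
        using V_le_CVaR_integrand[OF 1 q] by simp
    next
      case 2
      let ?v = "u a"
      have v: "1 \<le> ?v" using 2 u_ge by simp
      \<comment> \<open>Cutting at \<open>a\<close> leaves
        \<open>?c * (?v - 2) \<le> 1 - ?v + ?v * ln ?v\<close>; by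
        \<open>exp ?c = 2 * ?c + 1\<close> this is \<open>ln z \<le> z - 1\<close> at
        \<open>z = exp ?c / ?v\<close>.\<close>
      have "1 - exp ?c / ?v \<le> - ln (exp ?c / ?v)"
        using ln_le_minus_one[of "exp ?c / ?v"] v by simp
      also have "\<dots> = ln ?v - ?c" using v by (simp add: ln_div)
      finally have "?v - exp ?c \<le> ?v * (ln ?v - ?c)"
        using mult_left_mono[of "1 - exp ?c / ?v" "ln ?v - ?c" ?v] v
        by (simp add: right_diff_distrib)
      then have "?c * (?v - 2) \<le> 1 - ?v + ?v * ln ?v"
        using ski_c by (simp add: algebra_simps)
      then have "?c * (?v - 2) / (?c * (E - 1)) \<le> (1 - ?v + ?v * ln ?v) / (?c * (E - 1))"
        using c_pos E_gt by (intro divide_right_mono) auto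
      then have "1 + (E - ?v) / (E - 1) + (?v - 2) / (E - 1) \<le> V a a 1"
        unfolding V_def u_1 using a_eq[of a] c_pos by simp
      then have "\<alpha> \<le> V a a 1"
        by (simp only: alpha_split)
      then show ?thesis
        using V_le_CVaR_integrand[of a a] 2 q by (force intro: order_trans[of _ "ereal (V a a 1)"])
    next
      case 3
      \<comment> \<open>From here on the threshold alone is at least 2, which exceeds
        \<open>\<alpha>\<close>.\<close>
      have "0 \<le> 1 / (E - 1)"
        using E_gt by simp
      then have "\<alpha> \<le> 1 + a"
        using 3 unfolding \<alpha>_def by linarith
      then have "ereal \<alpha> \<le> ereal (1 + a) + 0" by simp
      also have "\<dots> \<le> ereal (1 + a) + ereal (1 / (1 - \<delta>)) *
          enn2ereal (\<integral>\<^sup>+x. ennreal (max 0 (ski_cost x 1 - (1 + a))) \<partial>ski_law \<delta>)"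
        using delta by (intro add_left_mono) auto
      finally show ?thesis .
    qed
  qed
  from this[of "t - 1" for t] show ?thesis
    unfolding CVaR_def using delta by (auto intro!: INF_greatest)
qed

lemma CVaR_competitive_ratio_ski_law: "CVaR_competitive_ratio \<delta> (ski_law \<delta>) = ereal \<alpha>"
proof (rule antisym)
  show "CVaR_competitive_ratio \<delta> (ski_law \<delta>) \<le> ereal \<alpha>"
    unfolding CVaR_competitive_ratio_def by (auto intro!: SUP_least CVaR_ratio_at_le)
  have "ereal \<alpha> \<le> CVaR_ratio_at \<delta> (ski_law \<delta>) 1"
    unfolding CVaR_ratio_at_def using alpha_le_CVaR by (simp add: one_ereal_def[symmetric])
  then show "ereal \<alpha> \<le> CVaR_competitive_ratio \<delta> (ski_law \<delta>)"
    unfolding CVaR_competitive_ratio_def by (auto intro: SUP_upper2[of 1])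
qed

end

theorem theorem1:
  fixes \<delta> :: real
  assumes "0 \<le> \<delta>" and "\<delta> < 1"
  shows "(\<forall>x\<in>{0..1}. 0 \<le> ski_density \<delta> x) \<and>
         ski_strategy (ski_law \<delta>) \<and>
         CVaR_competitive_ratio \<delta> (ski_law \<delta>) =
           ereal (2 - 1 / (exp (ski_c / (1 - \<delta>)) - 1)) \<and>
         CVaR_competitive_ratio \<delta> (ski_law \<delta>) < 2"
proof -
  interpret ski_rental \<delta>
    using assms by unfold_locales
  have "\<alpha> < 2"
    using E_gt by (simp add: \<alpha>_def)
  then have "ereal \<alpha> < 2"
    by (metis less_ereal.simps(1) numeral_eq_ereal)
  then show ?thesis
    using ski_density_nonneg ski_strategy_ski_law CVaR_competitive_ratio_ski_law
    by (simp add: \<alpha>_def E_def)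
qed

end
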